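(* Let $n\ge 3$ and let $W_{n+1}$ be the wheel graph on $n+1$ vertices. Then $$\mathcal{L}(W_{n+1})=n\left((n-1)!-2^{n-2}+2^{n-1}\sum_{k=0}^{n-1}\frac{k!}{2^{k}}\right).$$
   Context: Let $H$ be a finite, connected, undirected graph with vertex set $V$. A random walk labeling of $H$ is a labeling of $V$ obtainable by the following process: (1) set $i=1$, choose any $v\in V$ and label $v$ with $i$; (2) as long as there are unlabeled vertices, choose a vertex $w$ adjacent to the current vertex $v$ and replace $v$ by $w$; if this new $v$ is not labeled, increase $i$ by $1$ and label $v$ with $i$. The number of different random walk labelings of $H$ is denoted by $\mathcal{L}(H)$. The wheel graph $W_{n+1}$ is formed by adding one new vertex to the cycle graph $C_n$ on $n$ vertices and connecting it to all the vertices of $C_n$. *)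

theory Defs
  imports Complex_Main "Graph_Theory.Graph_Theory"
begin

text \<open>
  Undirected graphs are symmetric digraphs: in \<open>pair_graph G\<close> both \<open>(v, w)\<close> and \<open>(w, v)\<close>
  belong to \<open>parcs G\<close> for every edge.

  A state of the labeling process consists of the current vertex, the partial labeling built so
  far and the last label used.
\<close>

inductive labeling_state :: "'a pair_pre_digraph \<Rightarrow> 'a \<Rightarrow> ('a \<rightharpoonup> nat) \<Rightarrow> nat \<Rightarrow> bool"
  for G :: "'a pair_pre_digraph" where
  start: "v \<in> pverts G \<Longrightarrow> labeling_state G v [v \<mapsto> 1] 1"
| move_unlabeled: "labeling_state G v l i \<Longrightarrow> dom l \<noteq> pverts G \<Longrightarrow> (v, w) \<in> parcs G \<Longrightarrow>
    w \<notin> dom l \<Longrightarrow> labeling_state G w (l(w \<mapsto> i + 1)) (i + 1)"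
| move_labeled: "labeling_state G v l i \<Longrightarrow> dom l \<noteq> pverts G \<Longrightarrow> (v, w) \<in> parcs G \<Longrightarrow>
    w \<in> dom l \<Longrightarrow> labeling_state G w l i"

definition random_walk_labelings :: "'a pair_pre_digraph \<Rightarrow> ('a \<rightharpoonup> nat) set" where
  "random_walk_labelings G = {l. dom l = pverts G \<and> (\<exists>v i. labeling_state G v l i)}"

text \<open>Intended for finite connected \<open>pair_graph\<close>s.\<close>

definition num_random_walk_labelings :: "'a pair_pre_digraph \<Rightarrow> nat" where
  "num_random_walk_labelings G = card (random_walk_labelings G)"

text \<open>A cycle for \<open>n \<ge> 3\<close> only.\<close>

definition cycle_graph :: "nat \<Rightarrow> nat pair_pre_digraph" where
  "cycle_graph n = \<lparr> pverts = {0..<n},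
     parcs = {(i, j). i < n \<and> j < n \<and> (j = (i + 1) mod n \<or> i = (j + 1) mod n)} \<rparr>"

text \<open>\<open>None\<close> is the new vertex.\<close>

definition add_universal_vertex :: "'a pair_pre_digraph \<Rightarrow> 'a option pair_pre_digraph" where
  "add_universal_vertex G = \<lparr> pverts = insert None (Some ` pverts G),
     parcs = {(Some u, Some v) | u v. (u, v) \<in> parcs G}
           \<union> {(None, Some v) | v. v \<in> pverts G} \<union> {(Some v, None) | v. v \<in> pverts G} \<rparr>"

text \<open>As in \<open>W\<^bsub>n+1\<^esub>\<close>, the index counts all vertices, including the new one.\<close>

definition wheel_graph :: "nat \<Rightarrow> nat option pair_pre_digraph" where
  "wheel_graph m = add_universal_vertex (cycle_graph (m - 1))"

lemma pair_graph_cycle_graph: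
  assumes "n \<ge> 3"
  shows "pair_graph (cycle_graph n)"
proof
  show "finite (parcs (cycle_graph n))"
    by (rule finite_subset[of _ "{0..<n} \<times> {0..<n}"]) (auto simp: cycle_graph_def)
  show "fst e \<noteq> snd e" if "e \<in> parcs (cycle_graph n)" for e
    using that assms by (auto simp: cycle_graph_def mod_Suc split: if_splits)
qed (auto simp: cycle_graph_def symmetric_def intro!: symI)

lemma pair_graph_add_universal_vertex:
  assumes "pair_graph G"
  shows "pair_graph (add_universal_vertex G)"
proof -
  interpret pair_graph G by fact
  show ?thesis
  proof
    have "parcs (add_universal_vertex G) \<subseteq>
        pverts (add_universal_vertex G) \<times> pverts (add_universal_vertex G)"
      by (auto simp: add_universal_vertex_def dest: in_arcsD1 in_arcsD2)
    then show "finite (parcs (add_universal_vertex G))"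
      by (rule finite_subset) (simp add: add_universal_vertex_def pair_finite_verts)
    show "symmetric (add_universal_vertex G)"
      using pair_sym_arcs by (auto simp: add_universal_vertex_def symmetric_def sym_def)
  qed (auto simp: add_universal_vertex_def pair_finite_verts dest: in_arcsD1 in_arcsD2 pair_no_loops)
qed

lemma connected_add_universal_vertex:
  assumes "pair_graph G"
  shows "Digraph_Component.connected (add_universal_vertex G)"
proof -
  interpret H: pair_graph "add_universal_vertex G"
    using assms by (rule pair_graph_add_universal_vertex)
  let ?H = "with_proj (add_universal_vertex G)"
  have to_hub: "u \<rightarrow>\<^sup>*\<^bsub>?H\<^esub> None" "None \<rightarrow>\<^sup>*\<^bsub>?H\<^esub> u" if "u \<in> pverts (add_universal_vertex G)" for u
  proof -
    have "u = None \<or> (u, None) \<in> parcs (add_universal_vertex G) \<and>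
        (None, u) \<in> parcs (add_universal_vertex G)"
      using that by (auto simp: add_universal_vertex_def)
    then show "u \<rightarrow>\<^sup>*\<^bsub>?H\<^esub> None" "None \<rightarrow>\<^sup>*\<^bsub>?H\<^esub> u"
      using that by auto
  qed
  have "strongly_connected ?H"
  proof (rule strongly_connectedI)
    show "verts ?H \<noteq> {}"
      by (simp add: add_universal_vertex_def)
    show "u \<rightarrow>\<^sup>*\<^bsub>?H\<^esub> v" if "u \<in> verts ?H" "v \<in> verts ?H" for u v
      using that to_hub(1)[of u] to_hub(2)[of v] by (auto intro: H.reachable_trans)
  qed
  then show ?thesis
    by (auto simp: Digraph_Component.connected_def strongly_connected_def
        intro: H.reachable_mk_symmetricI)
qed

lemma wheel_graph_finite_connected:
  assumes "n \<ge> 3"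
  shows "pair_graph (wheel_graph (n + 1))"
    and "Digraph_Component.connected (wheel_graph (n + 1))"
    and "card (pverts (wheel_graph (n + 1))) = n + 1"
  using assms
  by (simp_all add: wheel_graph_def pair_graph_cycle_graph pair_graph_add_universal_vertex
      connected_add_universal_vertex)
    (simp add: add_universal_vertex_def cycle_graph_def card_image)

end

theory Submission
  imports Defs
begin

text \<open>
  Because the walk can roam freely inside the labeled vertices, a labeling is the same as an
  ordering of the vertices in which every vertex but the first is adjacent to an earlier one. In
  the wheel, as soon as the hub is labeled, the remaining vertices may follow in any order. Until
  then the labeled vertices form an arc of the rim, and the next vertex is either the hub or one
  of the two rim vertices next to the arc, which coincide exactly if a single rim vertex is left.
\<close>

section \<open>Labelings as search orders\<close>

definition frontier :: "'a pair_pre_digraph \<Rightarrow> 'a set \<Rightarrow> 'a set" where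
  "frontier G S = {w \<in> pverts G - S. \<exists>u\<in>S. (u, w) \<in> parcs G}"

text \<open>\<open>S\<close> holds the vertices labeled so far. The start vertex is put into
  \<open>S\<close> and not into the list, since it alone has no earlier neighbour.\<close>

fun search_order :: "'a pair_pre_digraph \<Rightarrow> 'a set \<Rightarrow> 'a list \<Rightarrow> bool" where
  "search_order G S [] \<longleftrightarrow> True"
| "search_order G S (x # xs) \<longleftrightarrow> x \<in> frontier G S \<and> search_order G (insert x S) xs"

definition completions :: "'a pair_pre_digraph \<Rightarrow> 'a set \<Rightarrow> 'a list set" where
  "completions G S = {xs. search_order G S xs \<and> S \<union> set xs = pverts G}"

definition list_labeling :: "'a list \<Rightarrow> 'a \<rightharpoonup> nat" where
  "list_labeling xs = map_of (zip xs [1..<length xs + 1])"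

text \<open>The definition recurses from the front, which suits counting; a walk appends new
  vertices at the end, which needs this view.\<close>

lemma search_order_snoc:
  "search_order G S (xs @ [w]) \<longleftrightarrow> search_order G S xs \<and> w \<in> frontier G (S \<union> set xs)"
  by (induction xs arbitrary: S) auto

lemma search_order_distinct: "search_order G S xs \<Longrightarrow> distinct xs \<and> set xs \<subseteq> pverts G - S"
  by (induction xs arbitrary: S) (auto simp: frontier_def)

lemma search_order_Cons_distinct: "search_order G {x} xs \<Longrightarrow> distinct (x # xs)"
  using search_order_distinct by fastforce

lemma dom_list_labeling [simp]: "dom (list_labeling xs) = set xs"
  by (simp add: list_labeling_def del: upt_Suc)

lemma list_labeling_nth:
  assumes "distinct xs" "i < length xs"
  shows "list_labeling xs (xs ! i) = Some (i + 1)"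
  using assms by (simp add: list_labeling_def map_of_zip_nth del: upt_Suc)

lemma list_labeling_snoc:
  assumes "w \<notin> set xs"
  shows "list_labeling (xs @ [w]) = (list_labeling xs)(w \<mapsto> length xs + 1)"
proof -
  have "[1..<length (xs @ [w]) + 1] = [1..<length xs + 1] @ [length xs + 1]"
    by simp
  then have "list_labeling (xs @ [w]) = [w \<mapsto> length xs + 1] ++ list_labeling xs"
    unfolding list_labeling_def by (simp del: upt_Suc)
  also have "\<dots> = (list_labeling xs)(w \<mapsto> length xs + 1)"
  proof -
    \<comment> \<open>The right operand of \<open>++\<close> takes precedence, so the new label
      survives only because \<open>w\<close> has none in \<open>list_labeling xs\<close>.\<close>
    have "list_labeling xs w = None"
      using assms dom_list_labeling by (metis domIff)
    then show ?thesis
      by (auto simp: map_add_def fun_eq_iff split: option.split)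
  qed
  finally show ?thesis .
qed

text \<open>The label of a vertex reveals its position in a distinct list. Counting labelings thus
  becomes counting lists.\<close>

lemma inj_on_list_labeling: "inj_on list_labeling {xs. distinct xs}"
proof (rule inj_onI)
  fix xs ys :: "'a list"
  assume "xs \<in> {xs. distinct xs}" "ys \<in> {xs. distinct xs}" and eq: "list_labeling xs = list_labeling ys"
  then have d: "distinct xs" "distinct ys"
    by auto
  have sets: "set xs = set ys"
    using eq dom_list_labeling by metis
  show "xs = ys"
  proof (rule nth_equalityI)
    show "length xs = length ys"
      using d sets distinct_card by metis
    fix i
    assume i: "i < length xs"
    then obtain j where j: "j < length ys" "xs ! i = ys ! j"
      using sets by (metis in_set_conv_nth nth_mem)
    then have "Some (i + 1) = Some (j + 1)"
      using list_labeling_nth[OF d(1) i] list_labeling_nth[OF d(2) j(1)] eq by metis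
    then show "xs ! i = ys ! i"
      using j by simp
  qed
qed

section \<open>Walk states versus search orders\<close>

lemma labeling_state_current_labeled: "labeling_state G v l i \<Longrightarrow> v \<in> dom l"
  by (induction rule: labeling_state.induct) auto

text \<open>The vertices, listed by first visit, form a search order. The invariant also keeps the
  current vertex \<open>v\<close> in the list: it is the earlier neighbour that puts a newly reached
  vertex into the frontier.\<close>

lemma labeling_state_search_order:
  assumes "labeling_state G v l i" and "parcs G \<subseteq> pverts G \<times> pverts G"
  shows "\<exists>x xs. x \<in> pverts G \<and> search_order G {x} xs \<and> l = list_labeling (x # xs) \<and>
    i = length (x # xs) \<and> v \<in> set (x # xs)"
  using assms(1)
proof induction
  case (start v)
  then show ?case
    by (intro exI[of _ v] exI[of _ "[]"]) (simp add: list_labeling_def)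
next
  case (move_unlabeled v l i w)
  then obtain x xs where xs: "x \<in> pverts G" "search_order G {x} xs" "l = list_labeling (x # xs)"
    "i = length (x # xs)" "v \<in> set (x # xs)"
    by blast
  have w: "w \<notin> set (x # xs)"
    using move_unlabeled.hyps xs(3) by simp
  have "w \<in> frontier G ({x} \<union> set xs)"
    using move_unlabeled.hyps xs(5) w assms(2) by (auto simp: frontier_def)
  then have "search_order G {x} (xs @ [w])"
    using xs(2) by (simp add: search_order_snoc)
  moreover have "l(w \<mapsto> i + 1) = list_labeling (x # (xs @ [w]))"
    using list_labeling_snoc[OF w] xs(3,4) by simp
  ultimately show ?case
    using xs(1,4) by (intro exI[of _ x] exI[of _ "xs @ [w]"]) simp
next
  case (move_labeled v l i w)
  then obtain x xs where xs: "x \<in> pverts G" "search_order G {x} xs" "l = list_labeling (x # xs)"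
    "i = length (x # xs)"
    by blast
  moreover have "w \<in> set (x # xs)"
    using move_labeled.hyps xs(3) by simp
  ultimately show ?case
    by blast
qed

text \<open>\<open>move_labeled\<close> keeps labels and counter, so it can be iterated along a path
  of labeled vertices. The labeling must be incomplete because the process stops once every vertex
  is labeled.\<close>

lemma labeling_state_roam:
  assumes "(v, w) \<in> (parcs G \<inter> dom l \<times> dom l)\<^sup>*" "labeling_state G v l i" "dom l \<noteq> pverts G"
  shows "labeling_state G w l i"
  using assms by induction (auto intro: labeling_state.move_labeled)

text \<open>Each new vertex hangs on an earlier one, so \<open>x\<close> reaches everything inside
  the list; symmetry reverses these paths and joins any two vertices through
  \<open>x\<close>.\<close>

lemma search_order_connected:
  assumes "search_order G {x} xs" and "sym (parcs G)" and "u \<in> insert x (set xs)" "v \<in> insert x (set xs)"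
  shows "(u, v) \<in> (parcs G \<inter> insert x (set xs) \<times> insert x (set xs))\<^sup>*"
proof -
  have "\<forall>u\<in>insert x (set xs). (x, u) \<in> (parcs G \<inter> insert x (set xs) \<times> insert x (set xs))\<^sup>*"
    using assms(1)
  proof (induction xs rule: rev_induct)
    case (snoc w xs)
    let ?S = "insert x (set xs)" and ?T = "insert x (set (xs @ [w]))"
    have mono: "(parcs G \<inter> ?S \<times> ?S)\<^sup>* \<subseteq> (parcs G \<inter> ?T \<times> ?T)\<^sup>*"
      by (rule rtrancl_mono) auto
    obtain u where u: "u \<in> ?S" "(u, w) \<in> parcs G"
      using snoc.prems by (auto simp: search_order_snoc frontier_def)
    then have "(x, u) \<in> (parcs G \<inter> ?T \<times> ?T)\<^sup>*"
      using snoc mono by (auto simp: search_order_snoc)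
    moreover have "(u, w) \<in> parcs G \<inter> ?T \<times> ?T"
      using u by auto
    ultimately have "(x, w) \<in> (parcs G \<inter> ?T \<times> ?T)\<^sup>*"
      by (rule rtrancl_into_rtrancl)
    moreover have "\<forall>u\<in>?S. (x, u) \<in> (parcs G \<inter> ?S \<times> ?S)\<^sup>*"
      using snoc by (simp add: search_order_snoc)
    ultimately show ?case
      using mono by auto
  qed auto
  moreover have "sym ((parcs G \<inter> insert x (set xs) \<times> insert x (set xs))\<^sup>*)"
    using assms(2) by (intro sym_rtrancl) (auto simp: sym_def)
  ultimately show ?thesis
    using assms(3,4) by (meson rtrancl_trans symD)
qed

lemma search_order_labeling_state:
  assumes "search_order G {x} xs" "sym (parcs G)" "x \<in> pverts G"
  shows "\<exists>v. labeling_state G v (list_labeling (x # xs)) (length (x # xs))"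
  using assms(1)
proof (induction xs rule: rev_induct)
  case Nil
  then show ?case
    using labeling_state.start[OF assms(3)] by (intro exI[of _ x]) (simp add: list_labeling_def fun_upd_def)
next
  case (snoc w xs)
  let ?l = "list_labeling (x # xs)" and ?i = "length (x # xs)"
  have so: "search_order G {x} xs" and w: "w \<in> frontier G (insert x (set xs))"
    using snoc.prems by (auto simp: search_order_snoc)
  then obtain v where v: "labeling_state G v ?l ?i"
    using snoc.IH by blast
  obtain u where u: "u \<in> insert x (set xs)" "(u, w) \<in> parcs G"
    using w by (auto simp: frontier_def)
  have w': "w \<notin> set (x # xs)" and proper: "dom ?l \<noteq> pverts G"
    using w by (auto simp: frontier_def)
  have "v \<in> insert x (set xs)"
    using labeling_state_current_labeled[OF v] by simp
  \<comment> \<open>The walk may have ended far from \<open>w\<close>; it first goes through labeled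
    vertices to the neighbour \<open>u\<close> of \<open>w\<close>.\<close>
  then have "labeling_state G u ?l ?i"
    using labeling_state_roam[OF _ v proper] search_order_connected[OF so assms(2) _ u(1)] by simp
  then have "labeling_state G w (?l(w \<mapsto> ?i + 1)) (?i + 1)"
    using labeling_state.move_unlabeled proper u(2) w' by (metis dom_list_labeling)
  then show ?case
    using list_labeling_snoc[OF w'] by (intro exI[of _ w]) (simp add: fun_upd_def)
qed

lemma random_walk_labelings_eq:
  assumes "pair_graph G"
  shows "random_walk_labelings G =
    list_labeling ` (\<Union>x\<in>pverts G. (#) x ` completions G {x})"
proof -
  interpret pair_graph G by fact
  have E: "parcs G \<subseteq> pverts G \<times> pverts G"
    by (auto dest: in_arcsD1 in_arcsD2)
  have S: "sym (parcs G)"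
    using pair_sym_arcs by (simp add: symmetric_def)
  show ?thesis
  proof (intro equalityI subsetI)
    fix l
    assume "l \<in> random_walk_labelings G"
    then obtain v i where "labeling_state G v l i" and d: "dom l = pverts G"
      by (auto simp: random_walk_labelings_def)
    then obtain x xs where xs: "x \<in> pverts G" "search_order G {x} xs" "l = list_labeling (x # xs)"
      using labeling_state_search_order[OF _ E] by metis
    then show "l \<in> list_labeling ` (\<Union>x\<in>pverts G. (#) x ` completions G {x})"
      using d by (auto simp: completions_def)
  next
    fix l
    assume "l \<in> list_labeling ` (\<Union>x\<in>pverts G. (#) x ` completions G {x})"
    then show "l \<in> random_walk_labelings G"
      using search_order_labeling_state[OF _ S]
      by (fastforce simp: completions_def random_walk_labelings_def)
  qed
qed

section \<open>Recursive counting of completions\<close>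

lemma finite_completions:
  assumes "finite (pverts G)"
  shows "finite (completions G S)"
proof (rule finite_subset)
  show "completions G S \<subseteq> {xs. set xs \<subseteq> pverts G \<and> distinct xs}"
    using search_order_distinct by (fastforce simp: completions_def)
  show "finite {xs. set xs \<subseteq> pverts G \<and> distinct xs}"
    using assms by (rule finite_subset_distinct)
qed

lemma num_random_walk_labelings_eq:
  assumes "pair_graph G"
  shows "num_random_walk_labelings G = (\<Sum>x\<in>pverts G. card (completions G {x}))"
proof -
  interpret pair_graph G by fact
  have "inj_on list_labeling (\<Union>x\<in>pverts G. (#) x ` completions G {x})"
    using search_order_Cons_distinct
    by (intro inj_on_subset[OF inj_on_list_labeling]) (fastforce simp: completions_def)
  then have "num_random_walk_labelings G = card (\<Union>x\<in>pverts G. (#) x ` completions G {x})"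
    by (simp add: num_random_walk_labelings_def random_walk_labelings_eq[OF assms] card_image)
  also have "\<dots> = (\<Sum>x\<in>pverts G. card ((#) x ` completions G {x}))"
    using pair_finite_verts by (intro card_UN_disjoint) (auto simp: finite_completions)
  finally show ?thesis
    by (simp add: card_image)
qed

text \<open>Completions are sorted by their first entry. As \<open>S\<close> is a proper subset, the
  empty list is not among them.\<close>

lemma card_completions_rec:
  assumes "finite (pverts G)" "S \<subset> pverts G"
  shows "card (completions G S) = (\<Sum>x\<in>frontier G S. card (completions G (insert x S)))"
proof -
  have "completions G S = (\<Union>x\<in>frontier G S. (#) x ` completions G (insert x S))"
  proof (rule set_eqI)
    fix xs
    show "xs \<in> completions G S \<longleftrightarrow> xs \<in> (\<Union>x\<in>frontier G S. (#) x ` completions G (insert x S))"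
      using assms(2) by (cases xs) (auto simp: completions_def)
  qed
  also have "card \<dots> = (\<Sum>x\<in>frontier G S. card ((#) x ` completions G (insert x S)))"
    using assms(1) by (intro card_UN_disjoint) (auto simp: finite_completions frontier_def)
  finally show ?thesis
    by (simp add: card_image)
qed

lemma completions_all: "completions G (pverts G) = {[]}"
proof -
  have "xs = []" if "search_order G (pverts G) xs" for xs
    using that by (cases xs) (auto simp: frontier_def)
  then show ?thesis
    by (auto simp: completions_def)
qed

text \<open>With \<open>h\<close> labeled, the frontier is always the whole remainder, so every
  order of the remaining vertices is admissible.\<close>

lemma card_completions_universal:
  assumes "finite (pverts G)" "S \<subseteq> pverts G" "h \<in> S"
    and universal: "\<And>w. w \<in> pverts G - {h} \<Longrightarrow> (h, w) \<in> parcs G"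
  shows "card (completions G S) = fact (card (pverts G - S))"
  using assms(2,3)
proof (induction "card (pverts G - S)" arbitrary: S)
  case 0
  then have "S = pverts G"
    using assms(1) by auto
  then show ?case
    by (simp add: completions_all)
next
  case (Suc m)
  have "frontier G S = pverts G - S"
    using universal Suc.prems by (auto simp: frontier_def)
  moreover have "S \<subset> pverts G"
    using Suc.hyps(2) Suc.prems(1) by (metis Diff_cancel card.empty nat.distinct(1) psubsetI)
  ultimately have "card (completions G S) = (\<Sum>x\<in>pverts G - S. card (completions G (insert x S)))"
    using card_completions_rec[OF assms(1)] by simp
  also have "\<dots> = (\<Sum>x\<in>pverts G - S. fact m)"
  proof (rule sum.cong)
    fix x
    assume x: "x \<in> pverts G - S"
    then have "card (pverts G - insert x S) = m"
      using Suc.hyps(2) assms(1) by (metis Diff_insert card_Diff_singleton diff_Suc_1)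
    then show "card (completions G (insert x S)) = fact m"
      using Suc.hyps(1)[of "insert x S"] Suc.prems x by auto
  qed simp
  finally show ?case
    by (simp flip: Suc.hyps(2))
qed

section \<open>Counting in the wheel\<close>

text \<open>The \<open>k\<close> consecutive rim vertices from \<open>a\<close> onwards. The start
  need not be below \<open>n\<close>, so an arc can grow to the left by moving its start to
  \<open>a + n - 1\<close>, which stands for \<open>a - 1\<close> modulo \<open>n\<close>.\<close>

definition arc :: "nat \<Rightarrow> nat \<Rightarrow> nat \<Rightarrow> nat set" where
  "arc n a k = (\<lambda>i. (a + i) mod n) ` {..<k}"

lemma arc_one: "a < n \<Longrightarrow> arc n a 1 = {a}"
  by (simp add: arc_def lessThan_Suc)

lemma arc_insert_right: "insert ((a + k) mod n) (arc n a k) = arc n a (Suc k)"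
  by (simp add: arc_def lessThan_Suc)

lemma arc_insert_left:
  assumes "n > 0"
  shows "insert ((a + n - 1) mod n) (arc n a k) = arc n (a + n - 1) (Suc k)"
proof -
  have "(a + n - 1 + Suc i) mod n = (a + i) mod n" for i
  proof -
    have "a + n - 1 + Suc i = a + i + n"
      using assms by simp
    then show ?thesis
      by (metis mod_add_self2)
  qed
  then show ?thesis
    by (simp only: arc_def lessThan_Suc_eq_insert_0 image_insert image_image add_0_right)
qed

text \<open>Offsets below \<open>n\<close> from a fixed start identify rim vertices, so membership
  in an arc reduces to comparing an offset with its length.\<close>

lemma add_mod_inj:
  fixes a i j n :: nat
  assumes "(a + i) mod n = (a + j) mod n" "i < n" "j < n"
  shows "i = j"
proof -
  have "i \<le> j \<longrightarrow> n dvd j - i" "j \<le> i \<longrightarrow> n dvd i - j"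
    using assms(1) mod_eq_dvd_iff_nat[of "a + i" "a + j" n] mod_eq_dvd_iff_nat[of "a + j" "a + i" n]
    by auto
  then show ?thesis
    using assms(2,3) by (metis diff_is_0_eq dvd_imp_le le_antisym less_imp_diff_less linorder_not_le
        nat_le_linear neq0_conv)
qed

lemma add_mod_mem_arc:
  assumes "i < n" "k \<le> n"
  shows "(a + i) mod n \<in> arc n a k \<longleftrightarrow> i < k"
  using assms add_mod_inj[of a i n] by (force simp: arc_def)

text \<open>Only the two ends of an arc can have a neighbour outside it. The two vertices listed
  coincide when \<open>k = n - 1\<close>.\<close>

lemma frontier_arc:
  assumes "1 \<le> k" "k < n"
  shows "frontier (cycle_graph n) (arc n a k) = {(a + k) mod n, (a + n - 1) mod n}"
proof (intro equalityI subsetI)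
  fix w
  assume "w \<in> frontier (cycle_graph n) (arc n a k)"
  then obtain i where w: "w < n" "w \<notin> arc n a k" and i: "i < k"
    and adj: "w = ((a + i) mod n + 1) mod n \<or> (a + i) mod n = (w + 1) mod n"
    by (auto simp: frontier_def cycle_graph_def arc_def)
  from adj show "w \<in> {(a + k) mod n, (a + n - 1) mod n}"
  proof
    assume "w = ((a + i) mod n + 1) mod n"
    then have "w = (a + Suc i) mod n"
      by (simp add: mod_Suc_eq)
    then show ?thesis
      using w add_mod_mem_arc[of "Suc i" n k a] i assms by (cases "Suc i = k") auto
  next
    assume eq: "(a + i) mod n = (w + 1) mod n"
    \<comment> \<open>Adding \<open>n - 1\<close> undoes the successor modulo \<open>n\<close>,
      which solves \<open>eq\<close> for \<open>w\<close>.\<close>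
    have "w = (w + 1 + (n - 1)) mod n"
      using w(1) by simp
    also have "\<dots> = (a + i + (n - 1)) mod n"
      using eq by (metis mod_add_left_eq)
    finally have w': "w = (a + i + (n - 1)) mod n" .
    show ?thesis
    proof (cases i)
      case 0
      then show ?thesis
        using w' assms by simp
    next
      case (Suc j)
      \<comment> \<open>Here \<open>w\<close> has offset \<open>j < k\<close> and would lie in the
        arc, a contradiction.\<close>
      have "w = (a + j + n) mod n"
        using w' Suc assms by simp
      then show ?thesis
        using w add_mod_mem_arc[of j n k a] Suc i assms by simp
    qed
  qed
next
  fix w
  assume "w \<in> {(a + k) mod n, (a + n - 1) mod n}"
  then consider "w = (a + k) mod n" | "w = (a + (n - 1)) mod n"
    using assms by force
  then show "w \<in> frontier (cycle_graph n) (arc n a k)"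
  proof cases
    case 1
    \<comment> \<open>The last vertex of the arc is the labeled neighbour of \<open>w\<close>; in
      the other case it is the first.\<close>
    have "(a + (k - 1)) mod n \<in> arc n a k" "w \<notin> arc n a k"
      using assms 1 add_mod_mem_arc[of "k - 1" n k a] add_mod_mem_arc[of k n k a] by auto
    moreover have "w = ((a + (k - 1)) mod n + 1) mod n"
      using 1 assms by (simp add: mod_Suc_eq)
    ultimately show ?thesis
      using assms 1 by (auto simp: frontier_def cycle_graph_def intro!: bexI[of _ "(a + (k - 1)) mod n"])
  next
    case 2
    have "(a + 0) mod n \<in> arc n a k" "w \<notin> arc n a k"
      using assms 2 add_mod_mem_arc[of 0 n k a] add_mod_mem_arc[of "n - 1" n k a] by auto
    moreover have "(a + 0) mod n = (w + 1) mod n"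
      using 2 assms by (simp add: mod_Suc_eq)
    ultimately show ?thesis
      using assms 2 by (auto simp: frontier_def cycle_graph_def intro!: bexI[of _ "(a + 0) mod n"])
  qed
qed

section \<open>Completions in the wheel\<close>

lemma frontier_add_universal_vertex:
  assumes "S \<subseteq> pverts G" "S \<noteq> {}"
  shows "frontier (add_universal_vertex G) (Some ` S) = insert None (Some ` frontier G S)"
  using assms by (auto simp: frontier_def add_universal_vertex_def)

lemma pverts_wheel: "pverts (wheel_graph (Suc n)) = insert None (Some ` {0..<n})"
  by (simp add: wheel_graph_def add_universal_vertex_def cycle_graph_def)

lemma card_completions_wheel_hub:
  assumes "S \<subseteq> {0..<n}"
  shows "card (completions (wheel_graph (n + 1)) (insert None (Some ` S))) = fact (n - card S)"
proof -
  have "card (completions (wheel_graph (n + 1)) (insert None (Some ` S))) =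
      fact (card (pverts (wheel_graph (n + 1)) - insert None (Some ` S)))"
    using assms by (intro card_completions_universal[where h = None])
      (auto simp: wheel_graph_def add_universal_vertex_def cycle_graph_def)
  also have "pverts (wheel_graph (n + 1)) - insert None (Some ` S) = Some ` ({0..<n} - S)"
    by (auto simp: pverts_wheel)
  also have "card \<dots> = n - card S"
    using assms by (simp add: card_image card_Diff_subset finite_subset)
  finally show ?thesis .
qed

lemma card_arc: "k \<le> n \<Longrightarrow> card (arc n a k) = k"
  unfolding arc_def by (subst card_image) (auto intro!: inj_onI dest: add_mod_inj)

lemma arc_subset: "n > 0 \<Longrightarrow> arc n a k \<subseteq> {0..<n}"
  by (auto simp: arc_def)

text \<open>The factorial counts the completions that take the hub next. The sum ranges over a set,
  so coinciding rim candidates are counted once.\<close>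

lemma card_completions_wheel_arc_rec:
  assumes "1 \<le> k" "k < n"
  shows "card (completions (wheel_graph (n + 1)) (Some ` arc n a k)) = fact (n - k) +
    (\<Sum>x\<in>{(a + k) mod n, (a + n - 1) mod n}.
      card (completions (wheel_graph (n + 1)) (Some ` insert x (arc n a k))))"
proof -
  let ?W = "wheel_graph (n + 1)" and ?F = "{(a + k) mod n, (a + n - 1) mod n}"
  have sub: "arc n a k \<subseteq> {0..<n}" and ne: "arc n a k \<noteq> {}"
    using assms by (auto simp: arc_def lessThan_empty_iff bot_nat_def)
  have "frontier ?W (Some ` arc n a k) = insert None (Some ` ?F)"
    using frontier_add_universal_vertex[of "arc n a k" "cycle_graph n"] sub ne frontier_arc[OF assms]
    by (simp add: wheel_graph_def cycle_graph_def)
  moreover have "finite (pverts ?W)" "Some ` arc n a k \<subset> pverts ?W"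
    using sub by (auto simp: pverts_wheel)
  ultimately have "card (completions ?W (Some ` arc n a k)) =
      (\<Sum>x\<in>insert None (Some ` ?F). card (completions ?W (insert x (Some ` arc n a k))))"
    using card_completions_rec by metis
  also have "\<dots> = card (completions ?W (insert None (Some ` arc n a k))) +
      (\<Sum>x\<in>Some ` ?F. card (completions ?W (insert x (Some ` arc n a k))))"
    by (rule sum.insert) auto
  also have "(\<Sum>x\<in>Some ` ?F. card (completions ?W (insert x (Some ` arc n a k)))) =
      (\<Sum>x\<in>?F. card (completions ?W (Some ` insert x (arc n a k))))"
    by (subst sum.reindex) (simp_all only: inj_on_def option.inject o_def image_insert, simp)
  finally show ?thesis
    using card_completions_wheel_hub[OF sub] assms by (simp add: card_arc)
qed

lemma card_completions_wheel_rim: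
  assumes "n > 0"
  shows "card (completions (wheel_graph (n + 1)) (Some ` {0..<n})) = 1"
proof -
  let ?W = "wheel_graph (n + 1)"
  have "frontier ?W (Some ` {0..<n}) = {None}"
    using assms by (auto simp: frontier_def wheel_graph_def add_universal_vertex_def cycle_graph_def)
  moreover have "finite (pverts ?W)" "Some ` {0..<n} \<subset> pverts ?W"
    by (auto simp: pverts_wheel)
  ultimately have "card (completions ?W (Some ` {0..<n})) = card (completions ?W (pverts ?W))"
    using card_completions_rec[of ?W "Some ` {0..<n}"] by (simp add: pverts_wheel)
  then show ?thesis
    by (simp add: completions_all)
qed

text \<open>With r rim vertices left, the count satisfies c(r) = r! + 2 c(r - 1) for r > 1. Starting
  this recursion at c(0) = 1 would give the first term; but c(1) is 2 and not 3, since the last rim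
  vertex is a single choice, and this deficit of 1 doubles \<open>m\<close> times.\<close>

lemma card_completions_wheel_arc:
  assumes "k \<ge> 1" "n = k + Suc m"
  shows "real (card (completions (wheel_graph (n + 1)) (Some ` arc n a k))) =
    2 ^ Suc m * (\<Sum>j = 0..Suc m. fact j / 2 ^ j) - 2 ^ m"
  using assms
proof (induction m arbitrary: a k)
  case 0
  have all: "insert x (arc n a k) = {0..<n}" if "x \<in> frontier (cycle_graph n) (arc n a k)" for x
  proof (rule card_subset_eq)
    show "insert x (arc n a k) \<subseteq> {0..<n}"
      using that 0 arc_subset[of n a k] by (auto simp: frontier_def cycle_graph_def)
    \<comment> \<open>\<open>arc_def\<close> under \<open>finite\<close> supplies the finiteness of
      the arc needed to count the inserted vertex.\<close>
    show "card (insert x (arc n a k)) = card {0..<n}"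
      using that 0 by (simp add: frontier_def card_arc arc_def[THEN arg_cong[of _ _ finite]])
  qed simp
  have "(a + n - 1) mod n = (a + k) mod n"
    using 0 by simp
  then have "card (completions (wheel_graph (n + 1)) (Some ` arc n a k)) = fact (n - k) + 1"
    using card_completions_wheel_arc_rec[of k n a] 0 all[of "(a + k) mod n"] frontier_arc[of k n a]
      card_completions_wheel_rim[of n] by (simp del: image_insert)
  then show ?case
    using 0 by simp
next
  case (Suc m)
  let ?c = "\<lambda>S. real (card (completions (wheel_graph (n + 1)) (Some ` S)))"
  have k: "1 \<le> k" "k < n" "n - k = Suc (Suc m)"
    using Suc.prems by auto
  \<comment> \<open>At least two rim vertices are left, so \<open>k < n - 1\<close> and the
    candidates are distinct.\<close>
  have "(a + k) mod n \<noteq> (a + (n - 1)) mod n"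
    using add_mod_inj[of a k n "n - 1"] Suc.prems by auto
  then have "(a + k) mod n \<noteq> (a + n - 1) mod n"
    using k by simp
  then have "?c (arc n a k) = fact (n - k) + (?c (insert ((a + k) mod n) (arc n a k)) +
      ?c (insert ((a + n - 1) mod n) (arc n a k)))"
    using card_completions_wheel_arc_rec[OF k(1,2), of a] by simp
  also have "\<dots> = fact (n - k) + (?c (arc n a (Suc k)) + ?c (arc n (a + n - 1) (Suc k)))"
    using k by (simp only: arc_insert_right arc_insert_left)
  \<comment> \<open>Both longer arcs have the same count: the induction hypothesis holds for every
    start, including \<open>a + n - 1\<close>.\<close>
  also have "\<dots> = fact (Suc (Suc m)) + 2 * (2 ^ Suc m * (\<Sum>j = 0..Suc m. fact j / 2 ^ j) - 2 ^ m)"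
    using Suc.IH[of "Suc k"] Suc.prems k(3) by simp
  also have "\<dots> = 2 ^ Suc (Suc m) * (\<Sum>j = 0..Suc (Suc m). fact j / 2 ^ j) - 2 ^ Suc m"
    by (simp add: field_simps del: fact_Suc)
  finally show ?case .
qed

theorem mainTheorem2:
  fixes n :: nat
  assumes "n \<ge> 3"
  shows "real (num_random_walk_labelings (wheel_graph (n + 1))) =
    real n * (fact (n - 1) - 2 ^ (n - 2) + 2 ^ (n - 1) * (\<Sum>k = 0..n - 1. fact k / 2 ^ k))"
proof -
  let ?c = "\<lambda>S. real (card (completions (wheel_graph (n + 1)) S))"
  have hub: "?c {None} = fact n"
    using card_completions_wheel_hub[of "{}" n] by simp
  have rim: "?c {Some a} = 2 ^ (n - 1) * (\<Sum>k = 0..n - 1. fact k / 2 ^ k) - 2 ^ (n - 2)"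
    if "a < n" for a
  proof -
    have "Suc (n - 2) = n - 1" "n = 1 + Suc (n - 2)"
      using assms by auto
    \<comment> \<open>A walk starting on the rim begins with an arc of length 1, leaving
      \<open>n - 1 = Suc (n - 2)\<close> rim vertices.\<close>
    then show ?thesis
      using card_completions_wheel_arc[of 1 n "n - 2" a] arc_one[OF that] by simp
  qed
  have "real (num_random_walk_labelings (wheel_graph (n + 1))) =
      (\<Sum>x\<in>insert None (Some ` {0..<n}). ?c {x})"
    using num_random_walk_labelings_eq[OF wheel_graph_finite_connected(1)[OF assms]]
    by (simp only: pverts_wheel of_nat_sum Suc_eq_plus1[symmetric])
  also have "\<dots> = ?c {None} + (\<Sum>a\<in>{0..<n}. ?c {Some a})"
    by (subst sum.insert) (auto simp: sum.reindex)
  also have "\<dots> = fact n + real n * (2 ^ (n - 1) * (\<Sum>k = 0..n - 1. fact k / 2 ^ k) - 2 ^ (n - 2))"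
    unfolding hub by (simp add: rim del: One_nat_def)
  \<comment> \<open>The hub start contributes \<open>fact n\<close>; splitting off \<open>n\<close>
    lets it share the common factor with the \<open>n\<close> rim starts.\<close>
  also have "fact n = real n * fact (n - 1)"
    using assms by (simp add: fact_reduce)
  finally show ?thesis
    by (simp add: algebra_simps)
qed

end
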